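(* Let $H=H(b,\delta,\lambda)$ be a balanced HST, let $W$ be a random $n$-element submultiset of its leaves, and let $h=\min(\delta,\log_b n)$. Then \[\mathbf{E}[MST(W)]=\Theta\Big(\sum_{\ell=1}^{h}(b\lambda)^\ell\Big),\] where the implied constants depend only on $b$ and $\lambda$.
   Context: A balanced HST $H(b,\delta,\lambda)$ (integers $b\ge2$, $\delta\ge1$, real $0<\lambda<1$) is a rooted tree in which every non-leaf vertex has exactly $b$ children and every leaf is at depth $\delta$; the root is at level $0$, and each edge joining a vertex at level $\ell-1$ to a child at level $\ell$ has weight $\lambda^\ell$. The distance $d_H(x,y)$ is the total weight of the tree path between $x$ and $y$. A random $n$-element submultiset of the leaves is obtained by choosing $n$ leaves independently and uniformly at random (repetitions allowed); copies of the same leaf are treated as distinct points at distance $0$. $MST(V)$ is the minimum total weight (with respect to $d_H$) of a spanning tree of the complete graph on the multiset $V$. The sum ranges over integers $\ell$ with $1\le\ell\le h$.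
   Formalization: The claim is proved for n = 1 and all n ≥ b; the range 2 ≤ n < b is excluded because there h < 1, so the sum is empty and equals 0 while E[MST(W)] > 0 (e.g. b = 3, n = 2, δ = 1 gives 4λ/3). *)

theory Defs
  imports "HOL-Probability.Probability"
begin

section \<open>Undirected graphs\<close>

text \<open>
  An edge is the two-element set of its endpoints. (The spanning trees of the AFP entry
  \<open>Graph_Theory\<close> are not usable here: they only exclude directed cycles, so that a
  transitive tournament counts as a tree.)
\<close>

definition path_from_to :: "'v set set \<Rightarrow> 'v \<Rightarrow> 'v list \<Rightarrow> 'v \<Rightarrow> bool" where
  "path_from_to E x p y \<longleftrightarrow>
     p \<noteq> [] \<and> hd p = x \<and> last p = y \<and> distinct p \<and> successively (\<lambda>u v. {u, v} \<in> E) p"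

definition path_edges :: "'v list \<Rightarrow> 'v set set" where
  "path_edges p = {{p ! i, p ! Suc i} | i. Suc i < length p}"

definition is_cycle :: "'v set set \<Rightarrow> 'v list \<Rightarrow> bool" where
  "is_cycle E p \<longleftrightarrow>
     length p \<ge> 3 \<and> distinct p \<and> successively (\<lambda>u v. {u, v} \<in> E) p \<and> {last p, hd p} \<in> E"

definition complete_edges :: "'v set \<Rightarrow> 'v set set" where
  "complete_edges V = {{u, v} | u v. u \<in> V \<and> v \<in> V \<and> u \<noteq> v}"

definition is_tree :: "'v set \<Rightarrow> 'v set set \<Rightarrow> bool" where
  "is_tree V E \<longleftrightarrow>
     V \<noteq> {} \<and> E \<subseteq> complete_edges V \<and>
     (\<forall>u\<in>V. \<forall>v\<in>V. \<exists>p. path_from_to E u p v) \<and> (\<nexists>p. is_cycle E p)"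

definition spanning_tree :: "'v set \<Rightarrow> 'v set set \<Rightarrow> 'v set set \<Rightarrow> bool" where
  "spanning_tree V E T \<longleftrightarrow> T \<subseteq> E \<and> is_tree V T"


section \<open>The balanced HST\<close>

text \<open>
  The tree of branching \<open>b\<close> and depth \<open>\<delta>\<close> is unique up to isomorphism; its vertices are taken
  to be the words of length at most \<open>\<delta>\<close> over \<open>{..<b}\<close>. The root is \<open>[]\<close>, the children
  of \<open>v\<close> are the words \<open>v @ [i]\<close>, and the level of a vertex is its length.
\<close>

definition hst_verts :: "nat \<Rightarrow> nat \<Rightarrow> nat list set" where
  "hst_verts b \<delta> = {v. set v \<subseteq> {..<b} \<and> length v \<le> \<delta>}"

definition hst_children :: "nat \<Rightarrow> nat \<Rightarrow> nat list \<Rightarrow> nat list set" where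
  "hst_children b \<delta> v = {w \<in> hst_verts b \<delta>. \<exists>i. w = v @ [i]}"

definition hst_leaves :: "nat \<Rightarrow> nat \<Rightarrow> nat list set" where
  "hst_leaves b \<delta> = {v \<in> hst_verts b \<delta>. hst_children b \<delta> v = {}}"

definition hst_edges :: "nat \<Rightarrow> nat \<Rightarrow> nat list set set" where
  "hst_edges b \<delta> = {{v, w} | v w. v \<in> hst_verts b \<delta> \<and> w \<in> hst_children b \<delta> v}"

text \<open>The level of the lower endpoint is the maximum of the two levels.\<close>

definition hst_weight :: "real \<Rightarrow> nat list set \<Rightarrow> real" where
  "hst_weight lam e = lam ^ Max (length ` e)"

definition hst_dist :: "nat \<Rightarrow> nat \<Rightarrow> real \<Rightarrow> nat list \<Rightarrow> nat list \<Rightarrow> real" where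
  "hst_dist b \<delta> lam x y =
     (\<Sum>e\<in>path_edges (THE p. path_from_to (hst_edges b \<delta>) x p y). hst_weight lam e)"

lemma card_hst_children:
  assumes "v \<in> hst_verts b \<delta>" and "length v < \<delta>"
  shows "card (hst_children b \<delta> v) = b"
proof -
  have "hst_children b \<delta> v = (\<lambda>i. v @ [i]) ` {..<b}"
    using assms by (auto simp: hst_children_def hst_verts_def)
  then show ?thesis
    by (simp add: card_image inj_on_def)
qed

lemma hst_leaves_eq:
  assumes "b \<ge> 2"
  shows "hst_leaves b \<delta> = {v. set v \<subseteq> {..<b} \<and> length v = \<delta>}"
proof -
  have "length v = \<delta>" if "v \<in> hst_leaves b \<delta>" for v
    using that card_hst_children[of v b \<delta>] assms
    by (cases "length v < \<delta>") (auto simp: hst_leaves_def hst_verts_def)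
  then show ?thesis
    by (auto simp: hst_leaves_def hst_verts_def hst_children_def)
qed


section \<open>Minimum spanning trees of random leaves\<close>

text \<open>
  A multiset of \<open>n\<close> points is given as an indexed family \<open>W 0, \<dots>, W (n - 1)\<close>, and its spanning
  trees have the indices as vertices, so that repeated points remain distinct. The edge
  \<open>{i, j}\<close> has weight \<open>d (W i) (W j)\<close>; for symmetric \<open>d\<close> the order given by
  \<open>Min\<close> and \<open>Max\<close> is irrelevant.
\<close>

definition mst_weight :: "('a \<Rightarrow> 'a \<Rightarrow> real) \<Rightarrow> nat \<Rightarrow> (nat \<Rightarrow> 'a) \<Rightarrow> real" where
  "mst_weight d n W =
     Min {\<Sum>e\<in>T. d (W (Min e)) (W (Max e)) | T.
            spanning_tree {..<n} (complete_edges {..<n}) T}"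

definition random_leaves :: "nat \<Rightarrow> nat \<Rightarrow> nat \<Rightarrow> (nat \<Rightarrow> nat list) pmf" where
  "random_leaves b \<delta> n = Pi_pmf {..<n} [] (\<lambda>_. pmf_of_set (hst_leaves b \<delta>))"

definition expected_mst :: "nat \<Rightarrow> nat \<Rightarrow> real \<Rightarrow> nat \<Rightarrow> real" where
  "expected_mst b \<delta> lam n =
     measure_pmf.expectation (random_leaves b \<delta> n) (mst_weight (hst_dist b \<delta> lam) n)"

end

theory Submission
  imports Defs "HOL-Library.Sublist"
begin

text \<open>
  Let \<open>N\<^sub>l\<close> be the number of vertices on level \<open>l\<close> that have a chosen leaf below them. An edge
  between two leaves pays \<open>2 \<lambda>\<^sup>l\<close> for every level \<open>l\<close> at which their ancestors differ. A
  connected graph contains at least \<open>N\<^sub>l - 1\<close> edges that are split at level \<open>l\<close>, and joining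
  every leaf to the closest earlier one attains this on all levels at once, so
  \<open>MST(W) = 2 (\<Sum>l=1..\<delta>. \<lambda>\<^sup>l (N\<^sub>l - 1))\<close>. It remains to note that
  \<open>E[N\<^sub>l] = m (1 - (1 - 1 / m) ^ n)\<close> with \<open>m = b ^ l\<close>; this is at most \<open>min m n\<close>, and of order
  \<open>m\<close> when \<open>m \<le> n\<close>. The levels with \<open>b ^ l > n\<close> contribute a geometric tail dominated by
  the last term of the sum.
\<close>

section \<open>Paths and trees\<close>

lemma path_from_to_Cons:
  "path_from_to E x (x' # q # p) y \<longleftrightarrow>
     x' = x \<and> {x, q} \<in> E \<and> x \<notin> set (q # p) \<and> path_from_to E q (q # p) y"
  by (auto simp: path_from_to_def)

text \<open>Simple paths cannot be concatenated or reversed without further work, whereas the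
  closure is transitive and inherits symmetry. All connectivity arguments below pass through this
  equivalence.\<close>

lemma path_from_to_iff_rtrancl:
  "(\<exists>p. path_from_to E x p y) \<longleftrightarrow> (x, y) \<in> {(u, v). {u, v} \<in> E}\<^sup>*"
proof
  assume "\<exists>p. path_from_to E x p y"
  then obtain p where "path_from_to E x p y" by blast
  then show "(x, y) \<in> {(u, v). {u, v} \<in> E}\<^sup>*"
  proof (induction p arbitrary: x)
    case (Cons a p)
    then show ?case
      by (cases p)
        (auto simp: path_from_to_Cons path_from_to_def intro: converse_rtrancl_into_rtrancl)
  qed (simp add: path_from_to_def)
next
  assume "(x, y) \<in> {(u, v). {u, v} \<in> E}\<^sup>*"
  then show "\<exists>p. path_from_to E x p y"
  proof (induction rule: converse_rtrancl_induct)
    case base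
    show ?case by (rule exI[of _ "[y]"]) (simp add: path_from_to_def)
  next
    case (step x z)
    then obtain p where p: "path_from_to E z p y" by blast
    show ?case
    proof (cases "x \<in> set p")
      case True
      \<comment> \<open>The path already visits \<open>x\<close>. Cutting off everything before that
        visit keeps the vertices distinct.\<close>
      then obtain p1 p2 where "p = p1 @ x # p2" by (meson split_list)
      then have "path_from_to E x (x # p2) y"
        using p by (auto simp: path_from_to_def successively_append_iff)
      then show ?thesis by blast
    next
      case False
      then have "path_from_to E x (x # p) y"
        using p step.hyps by (cases p) (auto simp: path_from_to_def)
      then show ?thesis by blast
    qed
  qed
qed

text \<open>A discrete intermediate value argument: some step of the path is the one that leaves
  \<open>A\<close>. It serves both for cuts in spanning trees and for subtrees of the HST.\<close>

lemma path_from_to_leaves_set: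
  assumes "path_from_to E x p y" "x \<in> A" "y \<notin> A"
  obtains u v where "{u, v} \<in> E" "u \<in> set p" "v \<in> set p" "u \<in> A" "v \<notin> A"
  using assms
proof (induction p arbitrary: x thesis)
  case (Cons a p)
  show ?case
  proof (cases p)
    case Nil
    then show ?thesis using Cons.prems by (auto simp: path_from_to_def)
  next
    case (Cons q r)
    then have *: "a = x" "{x, q} \<in> E" "path_from_to E q p y"
      using Cons.prems by (auto simp: path_from_to_Cons)
    show ?thesis
    proof (cases "q \<in> A")
      case True
      then show ?thesis
        using Cons.IH[OF _ *(3)] Cons.prems by auto
    next
      case False
      then show ?thesis
        using Cons.prems(1)[of x q] Cons.prems * Cons by auto
    qed
  qed
qed (simp add: path_from_to_def)

lemma path_edges_Cons:
  "path_edges (x # q # p) = insert {x, q} (path_edges (q # p))"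
proof -
  have "path_edges (x # q # p) = (\<lambda>i. {(x # q # p) ! i, (q # p) ! i}) ` {i. i < Suc (length p)}"
    by (auto simp: path_edges_def)
  also have "{i. i < Suc (length p)} = insert 0 (Suc ` {i. i < length p})"
    by (auto simp: less_Suc_eq_0_disj)
  finally show ?thesis by (auto simp: path_edges_def image_image)
qed

lemma path_edges_singleton [simp]: "path_edges [x] = {}"
  by (simp add: path_edges_def)

lemma path_edges_subset: "e \<in> path_edges p \<Longrightarrow> e \<subseteq> set p"
  by (auto simp: path_edges_def)

lemma finite_path_edges: "finite (path_edges p)"
  by (rule finite_subset[of _ "Pow (set p)"]) (auto dest: path_edges_subset)

text \<open>A counterexample to acyclicity would give its largest vertex two smaller neighbours.\<close>

lemma is_tree_parent:
  fixes f :: "nat \<Rightarrow> nat"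
  assumes n: "n \<ge> 1" and f: "\<And>i. 0 < i \<Longrightarrow> i < n \<Longrightarrow> f i < i"
  shows "is_tree {..<n} ((\<lambda>i. {f i, i}) ` {1..<n})"
proof -
  define E where "E = (\<lambda>i. {f i, i}) ` {1..<n}"
  let ?R = "{(u, v). {u, v} \<in> E}"
  have "sym ?R" by (auto simp: sym_def insert_commute)
  then have sym: "sym (?R\<^sup>*)" by (rule sym_rtrancl)
  have to0: "(i, 0) \<in> ?R\<^sup>*" if "i < n" for i
    using that
  proof (induction i rule: less_induct)
    case (less i)
    show ?case
    proof (cases "i = 0")
      case False
      then have "(i, f i) \<in> ?R" using less.prems by (auto simp: E_def insert_commute)
      moreover have "(f i, 0) \<in> ?R\<^sup>*" using less f False by force
      ultimately show ?thesis by (rule converse_rtrancl_into_rtrancl)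
    qed simp
  qed
  have conn: "\<exists>p. path_from_to E u p v" if "u \<in> {..<n}" "v \<in> {..<n}" for u v
    unfolding path_from_to_iff_rtrancl
    using to0[of u] to0[of v] that sym by (meson lessThan_iff rtrancl_trans symD)
  have down: "v = f u" if "{u, v} \<in> E" "v < u" for u v
  proof -
    obtain i where i: "{u, v} = {f i, i}" "i \<in> {1..<n}"
      using \<open>{u, v} \<in> E\<close> unfolding E_def by (rule imageE)
    have "f i < i" using f[of i] i(2) by simp
    with i(1) \<open>v < u\<close> show ?thesis unfolding doubleton_eq_iff by auto
  qed
  have "\<not> is_cycle E p" for p
  proof
    assume cyc: "is_cycle E p"
    define m where "m = Max (set p)"
    have len: "length p \<ge> 3" and dist: "distinct p"
      using cyc by (auto simp: is_cycle_def)
    then have "m \<in> set p" unfolding m_def by (intro Max_in) auto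
    then obtain k where k: "k < length p" "p ! k = m" by (auto simp: in_set_conv_nth)
    have succ: "{p ! i, p ! Suc i} \<in> E" if "Suc i < length p" for i
      using cyc that by (auto simp: is_cycle_def successively_conv_nth)
    have "p \<noteq> []" using len by auto
    then have wrap: "{p ! (length p - 1), p ! 0} \<in> E"
      using cyc by (simp add: is_cycle_def last_conv_nth hd_conv_nth)
    have nb: "p ! i = f m" if "{m, p ! i} \<in> E" "i < length p" "i \<noteq> k" for i
    proof (rule down[OF that(1)])
      have "p ! i \<le> m" unfolding m_def using that by (intro Max_ge) auto
      moreover have "p ! i \<noteq> m" using k that dist by (auto simp: nth_eq_iff_index_eq)
      ultimately show "p ! i < m" by simp
    qed
    \<comment> \<open>\<open>s\<close> and \<open>t\<close> are the cyclic successor and predecessor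
      of position \<open>k\<close>. They differ because the cycle has at least three vertices, yet
      both would have to carry \<open>f m\<close>.\<close>
    define s where "s = (if Suc k = length p then 0 else Suc k)"
    define t where "t = (if k = 0 then length p - 1 else k - 1)"
    have "{m, p ! s} \<in> E"
      using succ[of k] wrap k(1) unfolding k(2)[symmetric] s_def
      by (cases "length p = Suc k") auto
    moreover have "{m, p ! t} \<in> E"
      using succ[of "k - 1"] wrap k(1) unfolding k(2)[symmetric] t_def
      by (cases k) (auto simp: insert_commute)
    moreover have "s < length p" "t < length p" "s \<noteq> k" "t \<noteq> k" "s \<noteq> t"
      using k len by (auto simp: s_def t_def)
    ultimately show False
      using nb[of s] nb[of t] dist by (simp add: nth_eq_iff_index_eq)
  qed
  moreover have "E \<subseteq> complete_edges {..<n}"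
  proof
    fix e assume "e \<in> E"
    then obtain i where i: "e = {f i, i}" "i \<in> {1..<n}" unfolding E_def by (rule imageE)
    then show "e \<in> complete_edges {..<n}"
      using f[of i] unfolding complete_edges_def by force
  qed
  moreover have "{..<n} \<noteq> {}" using n by (simp add: lessThan_empty_iff)
  ultimately show ?thesis
    using conn unfolding is_tree_def E_def[symmetric] by blast
qed

text \<open>Start with the value at a root and enlarge a set \<open>A\<close> of values one at a
  time. While a value is missing, connectivity supplies an edge from the preimage of
  \<open>A\<close> to its complement, so every new value is paid for by a new edge with two
  different values.\<close>

lemma card_image_le_crossing_edges:
  assumes tree: "is_tree V T" and fin: "finite V"
  shows "card (f ` V) \<le> card {e \<in> T. \<exists>u\<in>e. \<exists>v\<in>e. f u \<noteq> f v} + 1"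
proof -
  let ?C = "{e \<in> T. \<exists>u\<in>e. \<exists>v\<in>e. f u \<noteq> f v}"
  have "T \<subseteq> Pow V" using tree by (auto simp: is_tree_def complete_edges_def)
  then have finT: "finite T" using fin finite_subset by blast
  obtain r where r: "r \<in> V" using tree by (auto simp: is_tree_def)
  have "\<exists>A\<subseteq>f ` V. f r \<in> A \<and> card A = Suc k \<and> k \<le> card {e \<in> ?C. f ` e \<subseteq> A}"
    if "k < card (f ` V)" for k
    using that
  proof (induction k)
    case 0
    show ?case by (rule exI[of _ "{f r}"]) (use r in auto)
  next
    case (Suc k)
    then obtain A where A: "A \<subseteq> f ` V" "f r \<in> A" "card A = Suc k"
      "k \<le> card {e \<in> ?C. f ` e \<subseteq> A}" by auto
    have "A \<noteq> f ` V" using A(3) Suc.prems by auto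
    then obtain y where y: "y \<in> V" "f y \<notin> A" using A(1) by blast
    then obtain p where "path_from_to T r p y" using tree r unfolding is_tree_def by blast
    then obtain u v where uv: "{u, v} \<in> T" "f u \<in> A" "f v \<notin> A"
      by (rule path_from_to_leaves_set[of T r p y "f -` A"]) (use A y in auto)
    have v: "v \<in> V" using uv(1) \<open>T \<subseteq> Pow V\<close> by auto
    have finA: "finite A" using A(3) card.infinite by fastforce
    \<comment> \<open>The edge is new because the value \<open>f v\<close> at one of its ends lay
      outside the old \<open>A\<close>.\<close>
    have "insert {u, v} {e \<in> ?C. f ` e \<subseteq> A} \<subseteq> {e \<in> ?C. f ` e \<subseteq> insert (f v) A}"
      using uv by auto
    then have "card (insert {u, v} {e \<in> ?C. f ` e \<subseteq> A}) \<le> card {e \<in> ?C. f ` e \<subseteq> insert (f v) A}"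
      using finT by (intro card_mono) auto
    moreover have "card (insert {u, v} {e \<in> ?C. f ` e \<subseteq> A}) = Suc (card {e \<in> ?C. f ` e \<subseteq> A})"
      using finT uv by (intro card_insert_disjoint) auto
    ultimately show ?case
      using A uv v finA by (intro exI[of _ "insert (f v) A"]) auto
  qed
  moreover have "card (f ` V) - 1 < card (f ` V)"
    using r fin card_gt_0_iff[of "f ` V"] by auto
  ultimately obtain A where "card (f ` V) - 1 \<le> card {e \<in> ?C. f ` e \<subseteq> A}" by blast
  also have "\<dots> \<le> card ?C" using finT by (intro card_mono) auto
  finally show ?thesis by simp
qed

section \<open>Distances in the HST\<close>

lemma hst_edges_iff:
  "e \<in> hst_edges b \<delta> \<longleftrightarrow> (\<exists>v i. e = {v, v @ [i]} \<and> v @ [i] \<in> hst_verts b \<delta>)"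
proof
  assume "e \<in> hst_edges b \<delta>"
  then show "\<exists>v i. e = {v, v @ [i]} \<and> v @ [i] \<in> hst_verts b \<delta>"
    unfolding hst_edges_def hst_children_def by blast
next
  assume "\<exists>v i. e = {v, v @ [i]} \<and> v @ [i] \<in> hst_verts b \<delta>"
  then obtain v i where e: "e = {v, v @ [i]}" "v @ [i] \<in> hst_verts b \<delta>" by blast
  then have "v \<in> hst_verts b \<delta>" by (auto simp: hst_verts_def)
  with e show "e \<in> hst_edges b \<delta>"
    unfolding hst_edges_def hst_children_def by blast
qed

text \<open>The only edge between the subtree below \<open>w @ [i]\<close> and the rest is the one above \<open>w @ [i]\<close>.\<close>

lemma hst_path_crosses:
  assumes "path_from_to (hst_edges b \<delta>) x p y"
    and "prefix (w @ [i]) x \<noteq> prefix (w @ [i]) y"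
  shows "w \<in> set p" "w @ [i] \<in> set p"
proof -
  \<comment> \<open>This is the side of the cut containing \<open>x\<close>, be it the subtree or
    its complement, so both directions of crossing are treated at once.\<close>
  let ?A = "{z. prefix (w @ [i]) z = prefix (w @ [i]) x}"
  obtain u v where uv: "{u, v} \<in> hst_edges b \<delta>" "u \<in> set p" "v \<in> set p" "u \<in> ?A" "v \<notin> ?A"
    by (rule path_from_to_leaves_set[OF assms(1), of ?A]) (use assms(2) in auto)
  then have "prefix (w @ [i]) u \<noteq> prefix (w @ [i]) v" by auto
  then have "{u, v} = {w, w @ [i]}"
    using uv(1) by (auto simp: hst_edges_iff doubleton_eq_iff)
  then show "w \<in> set p" "w @ [i] \<in> set p"
    using uv(2,3) by (auto simp: doubleton_eq_iff)
qed

text \<open>A nonempty word \<open>w\<close> stands for the edge above it, of weight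
  \<open>lam ^ length w\<close>; in this sense the set consists of the edges from the root to
  \<open>x\<close>.\<close>

definition branch :: "'a list \<Rightarrow> 'a list set" where
  "branch x = {w. prefix w x \<and> w \<noteq> []}"

lemma branch_snoc: "branch (x @ [i]) = insert (x @ [i]) (branch x)"
  by (auto simp: branch_def)

lemma finite_branch: "finite (branch x)"
  by (rule finite_subset[of _ "set (prefixes x)"]) (auto simp: branch_def)

text \<open>The next vertex is forced. After descending to a child that is not above
  \<open>y\<close>, or after climbing although \<open>y\<close> lies below \<open>x\<close>, the
  rest of the path would have to cross back through \<open>x\<close>, which is already used.\<close>

lemma hst_path_step:
  assumes "path_from_to (hst_edges b \<delta>) x (x # q # p) y"
  shows "if prefix x y then \<exists>i. q = x @ [i] \<and> prefix q y else \<exists>i. x = q @ [i]"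
proof -
  have *: "{x, q} \<in> hst_edges b \<delta>" "x \<notin> set (q # p)" "path_from_to (hst_edges b \<delta>) q (q # p) y"
    using assms by (auto simp: path_from_to_Cons)
  from *(1) consider i where "q = x @ [i]" | i where "x = q @ [i]"
    by (auto simp: hst_edges_iff doubleton_eq_iff)
  then show ?thesis
  proof cases
    case (1 i)
    then have "prefix q y"
      using hst_path_crosses(1)[OF *(3), of x i] *(2) by auto
    moreover have "prefix x y" using \<open>prefix q y\<close> 1 append_prefixD by blast
    ultimately show ?thesis using 1 by auto
  next
    case (2 i)
    then have "\<not> prefix x y"
      using hst_path_crosses(2)[OF *(3), of q i] *(2) by auto
    then show ?thesis using 2 by auto
  qed
qed

text \<open>This justifies the \<open>THE\<close> in \<open>hst_dist\<close>: by
  \<open>hst_path_step\<close>, two paths with the same ends agree vertex by vertex.\<close>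

lemma hst_path_unique:
  assumes "path_from_to (hst_edges b \<delta>) x p y" "path_from_to (hst_edges b \<delta>) x p' y"
  shows "p = p'"
  using assms
proof (induction p arbitrary: x p')
  case (Cons a p)
  obtain p1 where p': "p' = x # p1" and a: "a = x"
    using Cons.prems by (cases p') (auto simp: path_from_to_def)
  show ?case
  proof (cases "x = y")
    case True
    then have "p = []" "p1 = []"
      using Cons.prems a p' by (auto simp: path_from_to_def split: if_splits)
    then show ?thesis using a p' by simp
  next
    case False
    then obtain q r q' r' where qr: "p = q # r" "p1 = q' # r'"
      using Cons.prems a p' by (cases p; cases p1) (auto simp: path_from_to_def)
    have "q = q'"
      using hst_path_step[of b \<delta> x q r y] hst_path_step[of b \<delta> x q' r' y] Cons.prems a p' qr
      by (auto split: if_splits simp: prefix_def)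
    then show ?thesis
      using Cons.IH[of q p1] Cons.prems a p' qr by (auto simp: path_from_to_Cons)
  qed
qed (simp add: path_from_to_def)

text \<open>The path consists of the edges on exactly one of the two branches. By
  \<open>hst_path_step\<close>, a step up removes one word from \<open>branch x - branch y\<close>
  and a step down removes one from \<open>branch y - branch x\<close>.\<close>

lemma hst_path_weight:
  assumes "path_from_to (hst_edges b \<delta>) x p y"
  shows "(\<Sum>e\<in>path_edges p. hst_weight lam e) =
         (\<Sum>w\<in>branch x - branch y. lam ^ length w) + (\<Sum>w\<in>branch y - branch x. lam ^ length w)"
  using assms
proof (induction p arbitrary: x)
  case (Cons a p)
  then have a: "a = x" by (simp add: path_from_to_def)
  show ?case
  proof (cases p)
    case Nil
    then have "x = y" using Cons.prems a by (simp add: path_from_to_def)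
    then show ?thesis using Nil by simp
  next
    case (Cons q r)
    have path: "path_from_to (hst_edges b \<delta>) x (x # q # r) y"
      and q: "path_from_to (hst_edges b \<delta>) q (q # r) y" "x \<notin> set (q # r)"
      using Cons.prems a Cons by (auto simp: path_from_to_Cons)
    \<comment> \<open>\<open>path_edges\<close> is a set, so the first edge adds its weight only if
      it does not recur later.\<close>
    have "{x, q} \<notin> path_edges (q # r)"
      using q(2) path_edges_subset by blast
    then have eq: "(\<Sum>e\<in>path_edges (a # p). hst_weight lam e) = hst_weight lam {x, q} +
        ((\<Sum>w\<in>branch q - branch y. lam ^ length w) + (\<Sum>w\<in>branch y - branch q. lam ^ length w))"
      using Cons.IH[of q] q Cons a by (simp add: path_edges_Cons finite_path_edges)
    show ?thesis
    proof (cases "prefix x y")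
      case True
      then obtain i where i: "q = x @ [i]" "prefix q y"
        using hst_path_step[OF path] by auto
      have "branch q - branch y = branch x - branch y"
        using i(2) True by (auto simp: branch_def intro: prefix_order.trans)
      moreover have "branch y - branch x = insert q (branch y - branch q)" "q \<notin> branch y - branch q"
        using i by (auto simp: branch_snoc) (auto simp: branch_def)
      moreover have "hst_weight lam {x, q} = lam ^ length q"
        using i by (simp add: hst_weight_def)
      ultimately show ?thesis unfolding eq by (simp add: finite_branch)
    next
      case False
      then obtain i where i: "x = q @ [i]"
        using hst_path_step[OF path] by auto
      have "branch y - branch x = branch y - branch q"
        using False i by (auto simp: branch_snoc) (auto simp: branch_def)
      moreover have "branch x - branch y = insert x (branch q - branch y)" "x \<notin> branch q - branch y"
        using i False by (auto simp: branch_snoc) (auto simp: branch_def)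
      moreover have "hst_weight lam {x, q} = lam ^ length x"
        using i by (simp add: hst_weight_def)
      ultimately show ?thesis unfolding eq by (simp add: finite_branch)
    qed
  qed
qed (simp add: path_from_to_def)

text \<open>Both vertices are connected to the root.\<close>

lemma hst_path_exists:
  assumes "x \<in> hst_verts b \<delta>" "y \<in> hst_verts b \<delta>"
  shows "\<exists>p. path_from_to (hst_edges b \<delta>) x p y"
proof -
  let ?R = "{(u, v). {u, v} \<in> hst_edges b \<delta>}"
  have "sym ?R" by (auto simp: sym_def insert_commute)
  then have sym: "sym (?R\<^sup>*)" by (rule sym_rtrancl)
  have "(z, []) \<in> ?R\<^sup>*" if "z \<in> hst_verts b \<delta>" for z
    using that
  proof (induction z rule: rev_induct)
    case (snoc i z)
    have "(z @ [i], z) \<in> ?R" using snoc.prems by (auto simp: hst_edges_iff)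
    moreover have "(z, []) \<in> ?R\<^sup>*" using snoc by (auto simp: hst_verts_def)
    ultimately show ?case by (rule converse_rtrancl_into_rtrancl)
  qed simp
  then show ?thesis
    unfolding path_from_to_iff_rtrancl using assms sym by (meson rtrancl_trans symD)
qed

text \<open>A prefix of \<open>x\<close> is determined by its length \<open>l\<close>, and it misses
  the branch of \<open>y\<close> exactly when the two words differ within their first
  \<open>l\<close> letters.\<close>

lemma sum_branch_diff:
  assumes "length x = \<delta>" "length y = \<delta>"
  shows "(\<Sum>w\<in>branch x - branch y. lam ^ length w) =
         (\<Sum>l=1..\<delta>. lam ^ l * of_bool (take l x \<noteq> take l y) :: real)"
proof -
  have "bij_betw (\<lambda>l. take l x) {l\<in>{1..\<delta>}. take l x \<noteq> take l y} (branch x - branch y)"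
  proof (rule bij_betw_imageI)
    show "inj_on (\<lambda>l. take l x) {l\<in>{1..\<delta>}. take l x \<noteq> take l y}"
      using assms by (auto simp: inj_on_def dest: arg_cong[where f = length])
    have "w \<in> (\<lambda>l. take l x) ` {l\<in>{1..\<delta>}. take l x \<noteq> take l y}"
      if "w \<in> branch x - branch y" for w
    proof (rule image_eqI[of _ _ "length w"])
      show w: "w = take (length w) x" using that by (auto simp: branch_def prefix_def)
      have "w \<noteq> take (length w) y" using that take_is_prefix[of "length w" y]
        by (auto simp: branch_def)
      moreover have "length w \<in> {1..\<delta>}"
        using that assms by (auto simp: branch_def Suc_le_eq dest: prefix_length_le)
      ultimately show "length w \<in> {l\<in>{1..\<delta>}. take l x \<noteq> take l y}"
        using w by simp
    qed
    moreover have "take l x \<in> branch x - branch y" if "l \<in> {1..\<delta>}" "take l x \<noteq> take l y" for l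
      using that assms by (auto simp: branch_def take_is_prefix) (auto simp: prefix_def)
    ultimately show "(\<lambda>l. take l x) ` {l\<in>{1..\<delta>}. take l x \<noteq> take l y} = branch x - branch y"
      by auto
  qed
  then have "(\<Sum>w\<in>branch x - branch y. lam ^ length w) =
    (\<Sum>l | l\<in>{1..\<delta>} \<and> take l x \<noteq> take l y. lam ^ length (take l x))"
    by (rule sum.reindex_bij_betw[symmetric])
  also have "\<dots> = (\<Sum>l | l\<in>{1..\<delta>} \<and> take l x \<noteq> take l y. lam ^ l)"
    using assms by (intro sum.cong) auto
  also have "\<dots> = (\<Sum>l=1..\<delta>. lam ^ l * of_bool (take l x \<noteq> take l y))"
    by (intro sum.mono_neutral_cong_left) auto
  finally show ?thesis .
qed

text \<open>Leaves have equal depth, so the two halves of the path have the same levels; hence the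
  factor 2.\<close>

lemma hst_dist_leaves:
  assumes "b \<ge> 2" "x \<in> hst_leaves b \<delta>" "y \<in> hst_leaves b \<delta>"
  shows "hst_dist b \<delta> lam x y = 2 * (\<Sum>l=1..\<delta>. lam ^ l * of_bool (take l x \<noteq> take l y))"
proof -
  have len: "length x = \<delta>" "length y = \<delta>" using assms by (auto simp: hst_leaves_eq)
  obtain p where p: "path_from_to (hst_edges b \<delta>) x p y"
    using hst_path_exists[of x b \<delta> y] assms by (auto simp: hst_leaves_def)
  then have "(THE p. path_from_to (hst_edges b \<delta>) x p y) = p"
    using hst_path_unique by blast
  then have "hst_dist b \<delta> lam x y = (\<Sum>e\<in>path_edges p. hst_weight lam e)"
    by (simp add: hst_dist_def)
  also have "\<dots> = (\<Sum>l=1..\<delta>. lam ^ l * of_bool (take l x \<noteq> take l y)) +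
                 (\<Sum>l=1..\<delta>. lam ^ l * of_bool (take l y \<noteq> take l x))"
    unfolding hst_path_weight[OF p] using len by (simp only: sum_branch_diff)
  also have "(\<Sum>l=1..\<delta>. lam ^ l * of_bool (take l y \<noteq> take l x)) =
             (\<Sum>l=1..\<delta>. lam ^ l * of_bool (take l x \<noteq> take l y))"
    by (intro sum.cong arg_cong2[where f = "(*)"] arg_cong[where f = of_bool]) auto
  finally show ?thesis by simp
qed

section \<open>The weight of a minimum spanning tree\<close>

text \<open>Each value is counted at the first index where it occurs.\<close>

lemma sum_first_occurrences:
  fixes f :: "nat \<Rightarrow> 'a"
  shows "(\<Sum>i<n. of_bool (f i \<notin> f ` {..<i})) = real (card (f ` {..<n}))"
proof (induction n)
  case (Suc n)
  then show ?case
    by (cases "f n \<in> f ` {..<n}")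
      (simp_all add: lessThan_Suc insert_absorb card_insert_if del: sum_of_bool_eq)
qed simp

text \<open>Take an earlier word sharing the longest prefix, up to length \<open>\<delta>\<close>,
  with \<open>W i\<close>. Agreement at one length implies agreement at all shorter ones, so this
  single choice is optimal on every level.\<close>

lemma closest_earlier:
  fixes W :: "nat \<Rightarrow> 'a list"
  assumes "0 < i"
  shows "\<exists>j<i. \<forall>l\<in>{1..\<delta>}. take l (W j) \<noteq> take l (W i) \<longleftrightarrow>
                 take l (W i) \<notin> (\<lambda>j. take l (W j)) ` {..<i}"
proof -
  let ?P = "\<lambda>l. l \<le> \<delta> \<and> (\<exists>j<i. take l (W j) = take l (W i))"
  have "?P 0" using assms by auto
  then have ex: "\<exists>k. ?P k \<and> (\<forall>l. ?P l \<longrightarrow> l \<le> k)"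
    by (rule ex_has_greatest_nat[where f = "\<lambda>l. l" and b = "Suc \<delta>"]) auto
  then obtain k j where kj: "k \<le> \<delta>" "j < i" "take k (W j) = take k (W i)"
    and max: "\<And>l. ?P l \<Longrightarrow> l \<le> k" by blast
  have same: "take l (W j) = take l (W i)" if "l \<le> k" for l
    using arg_cong[OF kj(3), of "take l"] that by (simp add: min_absorb1)
  show ?thesis
  proof (intro exI[of _ j] conjI ballI kj(2))
    fix l assume l: "l \<in> {1..\<delta>}"
    have "take l (W i) \<notin> (\<lambda>j. take l (W j)) ` {..<i}" if "take l (W j) \<noteq> take l (W i)"
    proof
      assume "take l (W i) \<in> (\<lambda>j. take l (W j)) ` {..<i}"
      then obtain j' where "j' < i" "take l (W j') = take l (W i)" by auto
      then have "l \<le> k" using max[of l] l by auto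
      then show False using same that by blast
    qed
    moreover have "take l (W j) \<in> (\<lambda>j. take l (W j)) ` {..<i}" using kj(2) by blast
    ultimately show "take l (W j) \<noteq> take l (W i) \<longleftrightarrow>
        take l (W i) \<notin> (\<lambda>j. take l (W j)) ` {..<i}" by metis
  qed
qed

lemma finite_spanning_tree_weights:
  fixes n :: nat
  shows "finite {\<Sum>e\<in>T. d (W (Min e)) (W (Max e)) | T. spanning_tree {..<n} (complete_edges {..<n}) T}"
proof -
  have "{T. spanning_tree {..<n} (complete_edges {..<n}) T} \<subseteq> Pow (Pow {..<n})"
    by (auto simp: spanning_tree_def complete_edges_def)
  then have "finite {T. spanning_tree {..<n} (complete_edges {..<n}) T}"
    by (rule finite_subset) auto
  then show ?thesis by (simp add: setcompr_eq_image)
qed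

lemma mst_weight_hst:
  assumes b: "b \<ge> 2" and n: "n \<ge> 1" and lam: "lam \<ge> 0"
    and W: "\<And>i. i < n \<Longrightarrow> W i \<in> hst_leaves b \<delta>"
  shows "mst_weight (hst_dist b \<delta> lam) n W =
         2 * (\<Sum>l=1..\<delta>. lam ^ l * (real (card ((\<lambda>i. take l (W i)) ` {..<n})) - 1))"
    (is "_ = ?M")
proof -
  let ?w = "\<lambda>T. \<Sum>e\<in>T. hst_dist b \<delta> lam (W (Min e)) (W (Max e))"
  have "\<forall>i\<in>{1..<n}. \<exists>j<i. \<forall>l\<in>{1..\<delta>}. take l (W j) \<noteq> take l (W i) \<longleftrightarrow>
                 take l (W i) \<notin> (\<lambda>j. take l (W j)) ` {..<i}"
    by (intro ballI closest_earlier) simp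
  from bchoice[OF this] obtain f where "\<forall>i\<in>{1..<n}. f i < i \<and> (\<forall>l\<in>{1..\<delta>}.
      take l (W (f i)) \<noteq> take l (W i) \<longleftrightarrow> take l (W i) \<notin> (\<lambda>j. take l (W j)) ` {..<i})"
    by blast
  then have f: "\<And>i. i \<in> {1..<n} \<Longrightarrow> f i < i"
    "\<And>i l. i \<in> {1..<n} \<Longrightarrow> l \<in> {1..\<delta>} \<Longrightarrow> take l (W (f i)) \<noteq> take l (W i) \<longleftrightarrow>
                 take l (W i) \<notin> (\<lambda>j. take l (W j)) ` {..<i}"
    by blast+
  \<comment> \<open>Every index \<open>i > 0\<close> is joined to its closest earlier one. The
    larger endpoint recovers \<open>i\<close>, so no two indices give the same edge.\<close>
  define T where "T = (\<lambda>i. {f i, i}) ` {1..<n}"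
  have "is_tree {..<n} T"
    unfolding T_def using n f(1) by (intro is_tree_parent) auto
  then have T: "spanning_tree {..<n} (complete_edges {..<n}) T"
    by (simp add: spanning_tree_def is_tree_def)
  have ends: "Max {f i, i} = i" "Min {f i, i} = f i" if "i \<in> {1..<n}" for i
    using f(1)[OF that] by auto
  have "inj_on (\<lambda>i. {f i, i}) {1..<n}"
    by (rule inj_on_inverseI[where g = Max]) (use ends in auto)
  then have "?w T = (\<Sum>i\<in>{1..<n}. hst_dist b \<delta> lam (W (f i)) (W i))"
    unfolding T_def using ends by (subst sum.reindex) (auto intro!: sum.cong simp del: Max_insert Min_insert)
  also have "\<dots> = (\<Sum>i\<in>{1..<n}. 2 * (\<Sum>l=1..\<delta>. lam ^ l *
                     of_bool (take l (W i) \<notin> (\<lambda>j. take l (W j)) ` {..<i})))"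
  proof (intro sum.cong refl)
    fix i assume i: "i \<in> {1..<n}"
    then have "W (f i) \<in> hst_leaves b \<delta>" "W i \<in> hst_leaves b \<delta>"
      using f(1)[OF i] W by auto
    then show "hst_dist b \<delta> lam (W (f i)) (W i) = 2 * (\<Sum>l=1..\<delta>. lam ^ l *
                     of_bool (take l (W i) \<notin> (\<lambda>j. take l (W j)) ` {..<i}))"
      unfolding hst_dist_leaves[OF b \<open>W (f i) \<in> hst_leaves b \<delta>\<close> \<open>W i \<in> hst_leaves b \<delta>\<close>]
      using f(2)[OF i] by (intro arg_cong[where f = "\<lambda>x. 2 * x"] sum.cong refl) simp
  qed
  also have "\<dots> = 2 * (\<Sum>l=1..\<delta>. lam ^ l *
                  (\<Sum>i\<in>{1..<n}. of_bool (take l (W i) \<notin> (\<lambda>j. take l (W j)) ` {..<i})))"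
    by (simp only: sum_distrib_left sum.swap[of _ "{1..<n}"])
  also have "\<dots> = ?M"
  proof -
    have "(\<Sum>i\<in>{1..<n}. of_bool (g i \<notin> g ` {..<i})) = real (card (g ` {..<n})) - 1"
      for g :: "nat \<Rightarrow> nat list"
    proof -
      \<comment> \<open>Index 0 is always a first occurrence but has no parent edge, which accounts
        for the \<open>- 1\<close>.\<close>
      have "{..<n} = insert 0 {1..<n}" using n by auto
      then have "(\<Sum>i<n. of_bool (g i \<notin> g ` {..<i})) =
                 1 + (\<Sum>i\<in>{1..<n}. of_bool (g i \<notin> g ` {..<i}) :: real)" by simp
      then show ?thesis by (simp add: sum_first_occurrences)
    qed
    then show ?thesis by simp
  qed
  finally have wT: "?w T = ?M" .
  have lower: "?M \<le> ?w T" if T: "spanning_tree {..<n} (complete_edges {..<n}) T" for T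
  proof -
    have tree: "is_tree {..<n} T" and sub: "T \<subseteq> complete_edges {..<n}"
      using T by (auto simp: spanning_tree_def)
    have "T \<subseteq> Pow {..<n}" using sub by (auto simp: complete_edges_def)
    then have finT: "finite T" by (rule finite_subset) auto
    have edge: "\<exists>u v. u < n \<and> v < n \<and> e = {u, v} \<and> Min e = u \<and> Max e = v" if "e \<in> T" for e
    proof -
      obtain u v where uv: "e = {u, v}" "u < n" "v < n"
        using \<open>e \<in> T\<close> sub by (auto simp: complete_edges_def)
      then show ?thesis
        by (cases "u \<le> v")
          (rule exI[of _ u], rule exI[of _ v], simp add: max_def min_def,
            rule exI[of _ v], rule exI[of _ u], simp add: max_def min_def insert_commute)
    qed
    have "real (card ((\<lambda>i. take l (W i)) ` {..<n})) - 1 \<le>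
          (\<Sum>e\<in>T. of_bool (take l (W (Min e)) \<noteq> take l (W (Max e))))" for l
    proof -
      have "{e \<in> T. \<exists>u\<in>e. \<exists>v\<in>e. take l (W u) \<noteq> take l (W v)} =
            {e \<in> T. take l (W (Min e)) \<noteq> take l (W (Max e))}"
      proof (intro Collect_cong conj_cong refl)
        fix e assume "e \<in> T"
        then obtain u v where uv: "e = {u, v}" "Min e = u" "Max e = v" using edge by blast
        show "(\<exists>u\<in>e. \<exists>v\<in>e. take l (W u) \<noteq> take l (W v)) =
              (take l (W (Min e)) \<noteq> take l (W (Max e)))"
          unfolding uv(2,3) unfolding uv(1) by auto
      qed
      then have "real (card ((\<lambda>i. take l (W i)) ` {..<n})) \<le>
            real (card {e \<in> T. take l (W (Min e)) \<noteq> take l (W (Max e))}) + 1"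
        using card_image_le_crossing_edges[OF tree, of "\<lambda>i. take l (W i)"] by simp
      also have "real (card {e \<in> T. take l (W (Min e)) \<noteq> take l (W (Max e))}) =
            (\<Sum>e\<in>T. of_bool (take l (W (Min e)) \<noteq> take l (W (Max e))))"
        using finT by (simp add: Int_def)
      finally show ?thesis by simp
    qed
    \<comment> \<open>The bounds on the single levels are added with the nonnegative weights
      \<open>lam ^ l\<close>.\<close>
    then have "?M \<le> 2 * (\<Sum>l=1..\<delta>. lam ^ l *
          (\<Sum>e\<in>T. of_bool (take l (W (Min e)) \<noteq> take l (W (Max e)))))"
      using lam by (intro mult_left_mono sum_mono) auto
    also have "\<dots> = (\<Sum>e\<in>T. 2 * (\<Sum>l=1..\<delta>. lam ^ l *
          of_bool (take l (W (Min e)) \<noteq> take l (W (Max e)))))"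
      by (simp only: sum_distrib_left sum.swap[of _ T])
    also have "\<dots> = ?w T"
    proof (intro sum.cong refl)
      fix e assume "e \<in> T"
      then have "W (Min e) \<in> hst_leaves b \<delta>" "W (Max e) \<in> hst_leaves b \<delta>"
        using edge[of e] W by metis+
      then show "2 * (\<Sum>l=1..\<delta>. lam ^ l * of_bool (take l (W (Min e)) \<noteq> take l (W (Max e)))) =
                 hst_dist b \<delta> lam (W (Min e)) (W (Max e))"
        using hst_dist_leaves[OF b] by simp
    qed
    finally show ?thesis .
  qed
  show ?thesis
    unfolding mst_weight_def
    by (rule Min_eqI[OF finite_spanning_tree_weights]) (use lower in blast, use wT[symmetric] T in blast)
qed

section \<open>Expectation\<close>

lemma card_words: "card {v. set v \<subseteq> {..<b::nat} \<and> length v = l} = b ^ l"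
  using card_lists_length_eq[of "{..<b}" l] by simp

lemma finite_words: "finite {v. set v \<subseteq> {..<b::nat} \<and> length v = l}"
  using finite_lists_length_eq[of "{..<b}" l] by simp

lemma
  assumes "b \<ge> 2"
  shows finite_hst_leaves: "finite (hst_leaves b \<delta>)"
    and card_hst_leaves: "card (hst_leaves b \<delta>) = b ^ \<delta>"
    and hst_leaves_nonempty: "hst_leaves b \<delta> \<noteq> {}"
proof -
  show "finite (hst_leaves b \<delta>)" "card (hst_leaves b \<delta>) = b ^ \<delta>"
    unfolding hst_leaves_eq[OF assms] by (rule finite_words, rule card_words)
  then show "hst_leaves b \<delta> \<noteq> {}" using assms by auto
qed

lemma card_leaves_below:
  assumes "b \<ge> 2" "set w \<subseteq> {..<b}" "length w = l" "l \<le> \<delta>"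
  shows "card {x \<in> hst_leaves b \<delta>. take l x = w} = b ^ (\<delta> - l)"
proof -
  have "{x \<in> hst_leaves b \<delta>. take l x = w} = (@) w ` {v. set v \<subseteq> {..<b} \<and> length v = \<delta> - l}"
  proof (intro equalityI subsetI)
    fix x assume x: "x \<in> {x \<in> hst_leaves b \<delta>. take l x = w}"
    then have "x = w @ drop l x" by (metis (mono_tags) append_take_drop_id mem_Collect_eq)
    moreover have "set (drop l x) \<subseteq> {..<b} \<and> length (drop l x) = \<delta> - l"
      using x set_drop_subset[of l x] assms(1) by (auto simp: hst_leaves_eq)
    ultimately show "x \<in> (@) w ` {v. set v \<subseteq> {..<b} \<and> length v = \<delta> - l}" by blast
  qed (use assms in \<open>auto simp: hst_leaves_eq\<close>)
  then show ?thesis by (simp add: card_image card_words inj_on_def)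
qed

lemma set_random_leaves:
  assumes "b \<ge> 2" "W \<in> set_pmf (random_leaves b \<delta> n)" "i < n"
  shows "W i \<in> hst_leaves b \<delta>"
  using assms finite_hst_leaves[OF assms(1)] hst_leaves_nonempty[OF assms(1)]
  by (auto simp: random_leaves_def set_Pi_pmf PiE_dflt_def set_pmf_of_set)

lemma finite_set_random_leaves:
  assumes "b \<ge> 2"
  shows "finite (set_pmf (random_leaves b \<delta> n))"
  unfolding random_leaves_def set_Pi_pmf[OF finite_lessThan]
  using finite_hst_leaves[OF assms] hst_leaves_nonempty[OF assms]
  by (intro finite_PiE_dflt) (auto simp: set_pmf_of_set)

text \<open>Missing \<open>w\<close> means that each of the \<open>n\<close> draws misses it. This
  is a product event, so independence turns the probability for one draw into an \<open>n\<close>-th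
  power.\<close>

lemma prob_prefix_missed:
  assumes "b \<ge> 2" "set w \<subseteq> {..<b}" "length w = l" "l \<le> \<delta>"
  shows "measure_pmf.prob (random_leaves b \<delta> n) {W. w \<notin> (\<lambda>i. take l (W i)) ` {..<n}} =
         (1 - 1 / real b ^ l) ^ n"
proof -
  note leaves = finite_hst_leaves[OF assms(1), of \<delta>] hst_leaves_nonempty[OF assms(1), of \<delta>]
  have "measure_pmf.prob (pmf_of_set (hst_leaves b \<delta>)) {x. take l x \<noteq> w} =
        1 - measure_pmf.prob (pmf_of_set (hst_leaves b \<delta>)) {x. take l x = w}"
    using measure_pmf.prob_compl[of "{x. take l x = w}" "pmf_of_set (hst_leaves b \<delta>)"]
    by (simp add: Compl_eq_Diff_UNIV[symmetric] Collect_neg_eq[symmetric])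
  also have "measure_pmf.prob (pmf_of_set (hst_leaves b \<delta>)) {x. take l x = w} =
             real b ^ (\<delta> - l) / real b ^ \<delta>"
    using card_leaves_below[OF assms] card_hst_leaves[OF assms(1), of \<delta>] leaves
    by (simp add: measure_pmf_of_set Int_def)
  also have "\<dots> = 1 / real b ^ l"
    using assms(1,4) by (simp add: power_diff)
  finally have single: "measure_pmf.prob (pmf_of_set (hst_leaves b \<delta>)) {x. take l x \<noteq> w} =
    1 - 1 / real b ^ l" .
  have "{W. w \<notin> (\<lambda>i. take l (W i)) ` {..<n}} = Pi {..<n} (\<lambda>_. {x. take l x \<noteq> w})"
    by (auto simp: Pi_def)
  then show ?thesis
    by (simp add: random_leaves_def measure_Pi_pmf_Pi single)
qed

text \<open>Linearity of expectation: the count is a sum of indicators, one for each of the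
  \<open>b ^ l\<close> words that may be hit.\<close>

lemma expected_prefixes:
  assumes "b \<ge> 2" "l \<le> \<delta>"
  shows "measure_pmf.expectation (random_leaves b \<delta> n)
           (\<lambda>W. real (card ((\<lambda>i. take l (W i)) ` {..<n}))) =
         real b ^ l * (1 - (1 - 1 / real b ^ l) ^ n)"
proof -
  let ?M = "random_leaves b \<delta> n"
  let ?V = "{v. set v \<subseteq> {..<b} \<and> length v = l}"
  let ?hit = "\<lambda>w. {W. w \<in> (\<lambda>i. take l (W i)) ` {..<n}}"
  have "measure_pmf.expectation ?M (\<lambda>W. real (card ((\<lambda>i. take l (W i)) ` {..<n}))) =
        measure_pmf.expectation ?M (\<lambda>W. \<Sum>w\<in>?V. indicator (?hit w) W)"
  proof (intro integral_cong_AE AE_pmfI)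
    fix W assume "W \<in> set_pmf ?M"
    then have "W i \<in> hst_leaves b \<delta>" if "i < n" for i
      using set_random_leaves assms(1) that by blast
    then have "(\<lambda>i. take l (W i)) ` {..<n} \<subseteq> ?V"
      using assms by (fastforce simp: hst_leaves_eq dest: in_set_takeD)
    then show "real (card ((\<lambda>i. take l (W i)) ` {..<n})) = (\<Sum>w\<in>?V. indicator (?hit w) W)"
      by (simp add: indicator_def of_bool_def sum.If_cases finite_words Int_absorb1 del: image_subset_iff)
  qed auto
  also have "\<dots> = (\<Sum>w\<in>?V. measure_pmf.prob ?M (?hit w))"
    by (subst Bochner_Integration.integral_sum)
      (auto intro!: integrable_measure_pmf_finite finite_set_random_leaves assms)
  also have "\<dots> = (\<Sum>w\<in>?V. 1 - (1 - 1 / real b ^ l) ^ n)"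
  proof (intro sum.cong refl)
    fix w assume "w \<in> ?V"
    then have "measure_pmf.prob ?M (- ?hit w) = (1 - 1 / real b ^ l) ^ n"
      using prob_prefix_missed[OF assms(1) _ _ assms(2), of w n] by (simp add: Collect_neg_eq[symmetric])
    then show "measure_pmf.prob ?M (?hit w) = 1 - (1 - 1 / real b ^ l) ^ n"
      using measure_pmf.prob_compl[of "?hit w" ?M] by (simp add: Compl_eq_Diff_UNIV)
  qed
  also have "\<dots> = real b ^ l * (1 - (1 - 1 / real b ^ l) ^ n)"
    by (simp add: card_words)
  finally show ?thesis .
qed

lemma expected_mst_eq:
  assumes "b \<ge> 2" "n \<ge> 1" "lam \<ge> 0"
  shows "expected_mst b \<delta> lam n =
         2 * (\<Sum>l=1..\<delta>. lam ^ l * (real b ^ l * (1 - (1 - 1 / real b ^ l) ^ n) - 1))"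
proof -
  let ?M = "random_leaves b \<delta> n"
  let ?N = "\<lambda>l W. real (card ((\<lambda>i. take l (W i)) ` {..<n}))"
  have int: "integrable (measure_pmf ?M) g" for g :: "_ \<Rightarrow> real"
    by (intro integrable_measure_pmf_finite finite_set_random_leaves assms)
  have "expected_mst b \<delta> lam n =
        measure_pmf.expectation ?M (\<lambda>W. 2 * (\<Sum>l=1..\<delta>. lam ^ l * (?N l W - 1)))"
    unfolding expected_mst_def
    by (intro integral_cong_AE AE_pmfI mst_weight_hst assms)
      (auto intro: set_random_leaves assms)
  also have "\<dots> = 2 * (\<Sum>l=1..\<delta>. lam ^ l * (measure_pmf.expectation ?M (?N l) - 1))"
    using int by (simp add: Bochner_Integration.integral_sum Bochner_Integration.integral_diff)
  also have "\<dots> = 2 * (\<Sum>l=1..\<delta>. lam ^ l * (real b ^ l * (1 - (1 - 1 / real b ^ l) ^ n) - 1))"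
    using assms(1) by (simp add: expected_prefixes)
  finally show ?thesis .
qed

section \<open>Estimates for the expected number of distinct values in \<open>n\<close> uniform
  draws from \<open>m\<close>\<close>

lemma distinct_count_le:
  assumes "m \<ge> (1::real)"
  shows "m * (1 - (1 - 1 / m) ^ n) \<le> m" "m * (1 - (1 - 1 / m) ^ n) \<le> real n"
proof -
  have "0 \<le> (1 - 1 / m) ^ n" using assms by simp
  then show "m * (1 - (1 - 1 / m) ^ n) \<le> m"
    using assms by (simp add: algebra_simps)
  have "1 + real n * (- 1 / m) \<le> (1 + (- 1 / m)) ^ n"
    using assms by (intro Bernoulli_inequality) (simp add: field_simps)
  then have "1 - (1 - 1 / m) ^ n \<le> real n / m" by simp
  then show "m * (1 - (1 - 1 / m) ^ n) \<le> real n"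
    using assms by (simp add: field_simps)
qed

lemma distinct_count_ge_1:
  assumes "m \<ge> (1::real)" "n \<ge> 1"
  shows "1 \<le> m * (1 - (1 - 1 / m) ^ n)"
proof -
  \<comment> \<open>The quantity grows with \<open>n\<close> and equals 1 for a single draw.\<close>
  have "(1 - 1 / m) ^ n \<le> (1 - 1 / m) ^ 1"
    using assms by (intro power_decreasing) auto
  then have "m * (1 / m) \<le> m * (1 - (1 - 1 / m) ^ n)"
    using assms by (intro mult_left_mono) auto
  then show ?thesis using assms by simp
qed

text \<open>Here \<open>1 - 1 / e > 3 / 5\<close> beats \<open>1 / m\<close> even for \<open>m = 2\<close>.\<close>

lemma distinct_count_ge:
  assumes "m \<ge> (2::real)" "m \<le> real n"
  shows "m / 10 \<le> m * (1 - (1 - 1 / m) ^ n) - 1"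
proof -
  have "1 - 1 / m \<le> exp (- (1 / m))" using exp_ge_add_one_self[of "- (1 / m)"] by simp
  then have "(1 - 1 / m) ^ n \<le> exp (- (1 / m)) ^ n"
    using assms by (intro power_mono) auto
  also have "\<dots> = exp (- (real n / m))" by (simp flip: exp_of_nat_mult)
  also have "\<dots> \<le> exp (- 1)" using assms by (simp add: field_simps)
  also have "\<dots> \<le> 2 / 5"
    using exp_lower_Taylor_quadratic[of 1] by (simp add: exp_minus field_simps)
  finally have "m * (1 - (1 - 1 / m) ^ n) \<ge> m * (3 / 5)"
    using assms by (intro mult_left_mono) auto
  \<comment> \<open>What remains is \<open>m / 2 \<ge> 1\<close>.\<close>
  then show ?thesis using assms(1) by linarith
qed

text \<open>For \<open>1 < n < b\<close> the sum is empty although the expectation is positive, so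
  no \<open>C\<close> could work there; hence the condition on \<open>n\<close>. For
  \<open>n = 1\<close> both sides vanish.\<close>

theorem theorem7:
  fixes b :: nat and lam :: real
  assumes "b \<ge> 2" and "0 < lam" and "lam < 1"
  shows "\<exists>c > 0. \<exists>C > 0. \<forall>(\<delta>::nat) (n::nat). \<delta> \<ge> 1 \<longrightarrow> n = 1 \<or> n \<ge> b \<longrightarrow>
           (let h = min (real \<delta>) (log (real b) (real n));
                S = (\<Sum>l | 1 \<le> l \<and> real l \<le> h. (real b * lam) ^ l)
            in c * S \<le> expected_mst b \<delta> lam n \<and> expected_mst b \<delta> lam n \<le> C * S)"
proof -
  \<comment> \<open>\<open>K\<close> bounds the levels beyond \<open>h\<close> relative to the last
    term of the sum.\<close>
  define K where "K = real b * lam / (1 - lam)"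
  define C where "C = 2 * (1 + K)"
  have "K \<ge> 0" unfolding K_def using assms by simp
  then have "C > 0" unfolding C_def by simp
  \<comment> \<open>The constant \<open>1 / 5\<close> is the \<open>1 / 10\<close> of
    \<open>distinct_count_ge\<close> times the factor 2 of the distance.\<close>
  have main: "1 / 5 * S \<le> expected_mst b \<delta> lam n \<and> expected_mst b \<delta> lam n \<le> C * S"
    if n: "n = 1 \<or> n \<ge> b" and S: "S = (\<Sum>l | 1 \<le> l \<and> real l \<le> min (real \<delta>) (log (real b) (real n)). (real b * lam) ^ l)"
    for \<delta> n S
  proof -
    have n1: "n \<ge> 1" using n assms(1) by auto
    \<comment> \<open>\<open>?A\<close> is the range of the sum, free of logarithms;
      \<open>?B\<close> holds the remaining levels of the tree.\<close>
    let ?A = "{l\<in>{1..\<delta>}. b ^ l \<le> n}"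
    let ?B = "{l\<in>{1..\<delta>}. n < b ^ l}"
    let ?q = "\<lambda>l. lam ^ l * (real b ^ l * (1 - (1 - 1 / real b ^ l) ^ n) - 1)"
    have "{l. 1 \<le> l \<and> real l \<le> min (real \<delta>) (log (real b) (real n))} = ?A"
      using assms(1) n1 by (auto simp: le_log_iff powr_realpow simp flip: of_nat_power)
    then have S: "S = (\<Sum>l\<in>?A. (real b * lam) ^ l)" using S by simp
    have "(\<Sum>l=1..\<delta>. ?q l) = (\<Sum>l\<in>?A \<union> ?B. ?q l)" by (rule sum.cong) auto
    also have "\<dots> = (\<Sum>l\<in>?A. ?q l) + (\<Sum>l\<in>?B. ?q l)"
      by (rule sum.union_disjoint) auto
    finally have E: "expected_mst b \<delta> lam n = 2 * ((\<Sum>l\<in>?A. ?q l) + (\<Sum>l\<in>?B. ?q l))"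
      using expected_mst_eq[of b n lam \<delta>] assms n1 by simp
    have pow_nat: "b ^ l \<ge> 2" if "l \<ge> 1" for l
      using order_trans[OF assms(1) self_le_power[of b l]] that assms(1) by simp
    have pow: "real b ^ l \<ge> 2" if "l \<ge> 1" for l
      using pow_nat[OF that] by (simp flip: of_nat_power)
    show ?thesis
    proof (cases "n = 1")
      case True
      have A: "?A = {}" using True pow_nat by fastforce
      have B: "(\<Sum>l\<in>?B. ?q l) = 0"
        using True assms(1) by (intro sum.neutral) simp
      show ?thesis unfolding S E A B by simp
    next
      case False
      then have nb: "n \<ge> b" using n by simp
      have "S / 10 \<le> (\<Sum>l\<in>?A. ?q l)"
        unfolding S sum_divide_distrib
      proof (rule sum_mono)
        fix l assume l: "l \<in> ?A"
        then have "real b ^ l / 10 \<le> real b ^ l * (1 - (1 - 1 / real b ^ l) ^ n) - 1"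
          using pow by (intro distinct_count_ge) (auto simp flip: of_nat_power)
        then have "lam ^ l * (real b ^ l / 10) \<le> ?q l"
          using assms by (intro mult_left_mono) auto
        then show "(real b * lam) ^ l / 10 \<le> ?q l" by (simp add: power_mult_distrib mult.commute)
      qed
      moreover have "0 \<le> (\<Sum>l\<in>?B. ?q l)"
      proof (rule sum_nonneg)
        fix l assume l: "l \<in> ?B"
        have "1 \<le> real b ^ l * (1 - (1 - 1 / real b ^ l) ^ n)"
          using distinct_count_ge_1[of "real b ^ l" n] pow[of l] l n1 by auto
        then show "0 \<le> ?q l" using assms by (intro mult_nonneg_nonneg) auto
      qed
      moreover have "(\<Sum>l\<in>?A. ?q l) \<le> S"
        unfolding S
      proof (rule sum_mono)
        fix l assume l: "l \<in> ?A"
        then have "real b ^ l \<ge> 1" using pow[of l] by simp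
        from distinct_count_le(1)[OF this, of n]
        have "?q l \<le> lam ^ l * real b ^ l" using assms by (intro mult_left_mono) (linarith, simp)
        then show "?q l \<le> (real b * lam) ^ l" by (simp add: power_mult_distrib mult.commute)
      qed
      moreover have "(\<Sum>l\<in>?B. ?q l) \<le> K * S"
      \<comment> \<open>A nonempty \<open>?B\<close> ensures \<open>k \<le> \<delta>\<close> for the
        \<open>k\<close> chosen below, so that term \<open>k\<close> really occurs in
        \<open>S\<close>.\<close>
      proof (cases "?B = {}")
        case True
        have "S \<ge> 0" unfolding S using assms by (intro sum_nonneg) auto
        then show ?thesis unfolding True using \<open>K \<ge> 0\<close> by simp
      next
        case False
        obtain k where k: "b ^ k \<le> n" "n < b ^ (k + 1)"
          using ex_power_ivl1[of b n] assms(1) n1 by auto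
        have "k < l" if "n < b ^ l" for l
          using le_less_trans[OF k(1) that] assms(1) by (simp add: power_strict_increasing_iff)
        then have B: "?B \<subseteq> {Suc k..\<delta>}" by (auto simp: Suc_le_eq)
        then obtain l where "l \<in> {Suc k..\<delta>}" using False by blast
        then have "k \<le> \<delta>" by simp
        \<comment> \<open>Here \<open>n \<ge> b\<close> enters: it puts \<open>k\<close>, the
          integer part of the logarithm of \<open>n\<close>, into the range of the sum.\<close>
        moreover have "k \<ge> 1" using k nb by (cases k) auto
        ultimately have "k \<in> ?A" using k by simp
        then have kS: "(real b * lam) ^ k \<le> S"
          unfolding S using assms by (intro member_le_sum) auto
        \<comment> \<open>Beyond level \<open>k\<close> the number of points \<open>n\<close> is the
          better bound on the distinct prefixes. It leaves a geometric series in \<open>lam\<close>,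
          and \<open>n < b ^ (k + 1)\<close> then matches it with term \<open>k\<close>.\<close>
        have "(\<Sum>l\<in>?B. ?q l) \<le> (\<Sum>l\<in>?B. real n * lam ^ l)"
        proof (rule sum_mono)
          fix l assume l: "l \<in> ?B"
          then have "real b ^ l \<ge> 1" using pow[of l] by simp
          from distinct_count_le(2)[OF this, of n]
          have "?q l \<le> lam ^ l * real n" using assms by (intro mult_left_mono) (linarith, simp)
          then show "?q l \<le> real n * lam ^ l" by (simp add: mult.commute)
        qed
        also have "\<dots> \<le> (\<Sum>l\<in>{Suc k..\<delta>}. real n * lam ^ l)"
          using assms B by (intro sum_mono2) auto
        also have "\<dots> = real n * (\<Sum>l=Suc k..\<delta>. lam ^ l)" by (simp add: sum_distrib_left)
        also have "\<dots> \<le> real n * (lam ^ Suc k / (1 - lam))"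
          using assms by (intro mult_left_mono) (auto simp: sum_gp divide_right_mono)
        also have "\<dots> \<le> real b ^ (k + 1) * (lam ^ Suc k / (1 - lam))"
          using less_imp_le[OF k(2)] assms
          by (intro mult_right_mono) (simp_all flip: of_nat_power of_nat_mult)
        also have "\<dots> = K * (real b * lam) ^ k"
          by (simp add: K_def power_mult_distrib)
        also have "\<dots> \<le> K * S"
          using kS \<open>K \<ge> 0\<close> by (rule mult_left_mono)
        finally show ?thesis .
      qed
      moreover have "C * S = 2 * S + 2 * (K * S)" by (simp add: C_def algebra_simps)
      moreover have "1 / 5 * S \<le> 2 * (X + Y) \<and> 2 * (X + Y) \<le> C * S"
        if "S / 10 \<le> X" "0 \<le> Y" "X \<le> S" "Y \<le> K * S" "C * S = 2 * S + 2 * (K * S)" for X Y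
        using that by auto
      ultimately show ?thesis unfolding E by blast
    qed
  qed
  have "1 / 5 > (0::real)" by simp
  with \<open>C > 0\<close> main show ?thesis unfolding Let_def by blast
qed

end
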